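(* Let $G = (G, \cdot)$ be a group. The following data are equivalent, in the sense that under the standard bijective correspondences between operations $\circ$ on $G$ making $(G,\cdot,\circ)$ a skew brace, regular subgroups $N \le \operatorname{Hol}(G)$, and gamma functions $\gamma : G \to \operatorname{Aut}(G)$ (recalled in the context), the following conditions on the corresponding $\circ$, $N$, $\gamma$ are equivalent (and in (5) the function $\gamma$ is not assumed in advance to be a gamma function): \begin{enumerate} \item[(1)] a bi-skew brace $(G, \cdot, \circ)$; \item[(2)] a regular subgroup $N$ of $\operatorname{Hol}(G)$ which is normalised by $\rho(G)$; \item[(3)] a gamma function $\gamma : G \to \operatorname{Aut}(G)$ which satisfies $\gamma(x y) = \gamma(y) \gamma(x)$ for all $x, y \in G$, that is, $\gamma$ is an anti-homomorphism; \item[(4)] a gamma function $\gamma : G \to \operatorname{Aut}(G)$ which satisfies $\gamma(x^{\gamma(y)}) = \gamma(x)^{\gamma(y)}$ for all $x, y \in G$; \item[(5)] a function $\gamma : G \to \operatorname{Aut}(G)$ which satisfies, for all $x, y \in G$, both $\gamma(x y) = \gamma(y)\gamma(x)$ and $\gamma(x^{\gamma(y)}) = \gamma(x)^{\gamma(y)}$; \item[(6)] a gamma function $\gamma : G \to \operatorname{Aut}(G)$ which satisfies $\gamma([G, \bar{\gamma}(G)]) = 1$; \item[(7)] a gamma function $\gamma : G \to \operatorname{Aut}(G)$ which satisfies $\gamma(x^{-1} y^{-1} x^{\gamma(y)} y) = 1$ for all $x, y \in G$. \end{enumerate}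
   Context: Maps act on the right and are written as exponents ($x^{\beta}$ is the image of $x$ under $\beta$), and products of maps are composed left to right; for elements $u,v$ of a group, $u^{v} = v^{-1} u v$. A (right) skew brace with additive group $(G,\cdot)$ is a triple $(G,\cdot,\circ)$ where $(G,\circ)$ is also a group and $(x y) \circ z = (x \circ z) \cdot z^{-1} \cdot (y \circ z)$ for all $x,y,z \in G$ (here $z^{-1}$ is the inverse in $(G,\cdot)$). It is a bi-skew brace if $(G,\circ,\cdot)$ is also a skew brace. A gamma function (GF) on $G$ is a function $\gamma : G \to \operatorname{Aut}(G)$ such that $\gamma(g^{\gamma(h)} h) = \gamma(g)\gamma(h)$ for all $g,h \in G$. Let $S(G)$ be the group of permutations of the set $G$, and $\rho : G \to S(G)$, $g \mapsto (x \mapsto xg)$, the right regular representation. The holomorph is $\operatorname{Hol}(G) = N_{S(G)}(\rho(G)) = \operatorname{Aut}(G)\rho(G)$. A subgroup of $S(G)$ is regular if it is transitive with trivial point stabilisers. Correspondences: a gamma function $\gamma$ corresponds to the skew brace operation $x \circ y = x^{\gamma(y)} y$ (so $x^{\gamma(y)} = (x\circ y) \cdot y^{-1}$) and to the regular subgroup $N = \{\gamma(y)\rho(y) : y \in G\} = \{x \mapsto x \circ y : y \in G\}$ of $\operatorname{Hol}(G)$. These give bijections between operations $\circ$ such that $(G,\cdot,\circ)$ is a skew brace, regular subgroups of $\operatorname{Hol}(G)$, and gamma functions on $G$. Let $\iota : G \to \operatorname{Aut}(G)$, $\iota(y) : x \mapsto y^{-1} x y$. For a gamma function $\gamma$, define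 $\bar{\gamma}(y) = \gamma(y^{-1})\iota(y^{-1})$ for $y \in G$; this is again a gamma function (the one associated to the conjugate of $N$ by the inversion map $x \mapsto x^{-1}$). For $x \in G$ and $\beta \in \operatorname{Aut}(G)$ write $[x,\beta] = x^{-1} x^{\beta}$, and $[G,\bar\gamma(G)]$ for the subgroup generated by all $[x,\bar\gamma(y)]$, $x,y\in G$. The condition $\gamma(S)=1$ for a set $S$ means $\gamma(s)=1$ for all $s \in S$. *)

theory Defs
  imports "HOL-Algebra.Algebra"
begin

(* Maps act on the right and products of maps are composed from left to right, whereas the
   multiplication of BijGroup composes from right to left; hence the opposite multiplication. *)
definition perm_group :: "'a set \<Rightarrow> ('a \<Rightarrow> 'a) monoid" where
  "perm_group S = (BijGroup S)\<lparr>mult := (\<lambda>f g. g \<otimes>\<^bsub>BijGroup S\<^esub> f)\<rparr>"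

definition aut_group :: "('a, 'b) monoid_scheme \<Rightarrow> ('a \<Rightarrow> 'a) monoid" where
  "aut_group G = (perm_group (carrier G))\<lparr>carrier := auto G\<rparr>"

definition conj_by :: "('a, 'b) monoid_scheme \<Rightarrow> 'a \<Rightarrow> 'a \<Rightarrow> 'a" where
  "conj_by G u v = inv\<^bsub>G\<^esub> v \<otimes>\<^bsub>G\<^esub> u \<otimes>\<^bsub>G\<^esub> v"

definition right_reg :: "('a, 'b) monoid_scheme \<Rightarrow> 'a \<Rightarrow> 'a \<Rightarrow> 'a" where
  "right_reg G g = (\<lambda>x\<in>carrier G. x \<otimes>\<^bsub>G\<^esub> g)"

definition holomorph :: "('a, 'b) monoid_scheme \<Rightarrow> ('a \<Rightarrow> 'a) set" where
  "holomorph G = normalizer (perm_group (carrier G)) (right_reg G ` carrier G)"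

definition regular_subgroup :: "('a \<Rightarrow> 'a) set \<Rightarrow> 'a set \<Rightarrow> bool" where
  "regular_subgroup N S \<longleftrightarrow>
     subgroup N (perm_group S) \<and>
     (\<forall>x\<in>S. \<forall>y\<in>S. \<exists>\<nu>\<in>N. \<nu> x = y) \<and>
     (\<forall>x\<in>S. {\<nu> \<in> N. \<nu> x = x} = {\<one>\<^bsub>perm_group S\<^esub>})"

definition hol_regular_subgroups :: "('a, 'b) monoid_scheme \<Rightarrow> ('a \<Rightarrow> 'a) set set" where
  "hol_regular_subgroups G = {N. N \<subseteq> holomorph G \<and> regular_subgroup N (carrier G)}"

(* Right skew braces: A is the additive group, M the group with the circle operation. *)
locale skew_brace = add: group A + circ: group M
  for A :: "('a, 'b) monoid_scheme" and M :: "('a, 'c) monoid_scheme" +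
  assumes same_carrier: "carrier M = carrier A"
    and brace_law: "\<lbrakk>x \<in> carrier A; y \<in> carrier A; z \<in> carrier A\<rbrakk> \<Longrightarrow>
      (x \<otimes>\<^bsub>A\<^esub> y) \<otimes>\<^bsub>M\<^esub> z = (x \<otimes>\<^bsub>M\<^esub> z) \<otimes>\<^bsub>A\<^esub> inv\<^bsub>A\<^esub> z \<otimes>\<^bsub>A\<^esub> (y \<otimes>\<^bsub>M\<^esub> z)"

(* The identity e of the circle group is left existential, since it is not part of the data. *)
definition skew_brace_op :: "('a, 'b) monoid_scheme \<Rightarrow> ('a \<Rightarrow> 'a \<Rightarrow> 'a) \<Rightarrow> bool" where
  "skew_brace_op G f \<longleftrightarrow> (\<exists>e. skew_brace G \<lparr>carrier = carrier G, monoid.mult = f, one = e\<rparr>)"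

definition bi_skew_brace_op :: "('a, 'b) monoid_scheme \<Rightarrow> ('a \<Rightarrow> 'a \<Rightarrow> 'a) \<Rightarrow> bool" where
  "bi_skew_brace_op G f \<longleftrightarrow>
     (\<exists>e. skew_brace G \<lparr>carrier = carrier G, monoid.mult = f, one = e\<rparr> \<and>
          skew_brace \<lparr>carrier = carrier G, monoid.mult = f, one = e\<rparr> G)"

(* Operations and functions on the carrier are taken extensional, so that the correspondences
   below are genuine bijections. *)
definition skew_brace_ops :: "('a, 'b) monoid_scheme \<Rightarrow> ('a \<Rightarrow> 'a \<Rightarrow> 'a) set" where
  "skew_brace_ops G =
     {f \<in> carrier G \<rightarrow>\<^sub>E carrier G \<rightarrow>\<^sub>E carrier G. skew_brace_op G f}"

(* The exponential x^beta is written beta x throughout. *)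
definition gamma_functions :: "('a, 'b) monoid_scheme \<Rightarrow> ('a \<Rightarrow> 'a \<Rightarrow> 'a) set" where
  "gamma_functions G =
     {\<gamma> \<in> carrier G \<rightarrow>\<^sub>E auto G.
        \<forall>g\<in>carrier G. \<forall>h\<in>carrier G.
          \<gamma> (\<gamma> h g \<otimes>\<^bsub>G\<^esub> h) = \<gamma> g \<otimes>\<^bsub>aut_group G\<^esub> \<gamma> h}"

definition gamma_op :: "('a, 'b) monoid_scheme \<Rightarrow> ('a \<Rightarrow> 'a \<Rightarrow> 'a) \<Rightarrow> 'a \<Rightarrow> 'a \<Rightarrow> 'a" where
  "gamma_op G \<gamma> = (\<lambda>x\<in>carrier G. \<lambda>y\<in>carrier G. \<gamma> y x \<otimes>\<^bsub>G\<^esub> y)"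

definition gamma_subgroup :: "('a, 'b) monoid_scheme \<Rightarrow> ('a \<Rightarrow> 'a \<Rightarrow> 'a) \<Rightarrow> ('a \<Rightarrow> 'a) set" where
  "gamma_subgroup G \<gamma> =
     (\<lambda>y. \<gamma> y \<otimes>\<^bsub>perm_group (carrier G)\<^esub> right_reg G y) ` carrier G"

definition op_translations :: "('a, 'b) monoid_scheme \<Rightarrow> ('a \<Rightarrow> 'a \<Rightarrow> 'a) \<Rightarrow> ('a \<Rightarrow> 'a) set" where
  "op_translations G f = (\<lambda>y. \<lambda>x\<in>carrier G. f x y) ` carrier G"

definition inner_aut :: "('a, 'b) monoid_scheme \<Rightarrow> 'a \<Rightarrow> 'a \<Rightarrow> 'a" where
  "inner_aut G y = (\<lambda>x\<in>carrier G. conj_by G x y)"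

definition gamma_bar :: "('a, 'b) monoid_scheme \<Rightarrow> ('a \<Rightarrow> 'a \<Rightarrow> 'a) \<Rightarrow> 'a \<Rightarrow> 'a \<Rightarrow> 'a" where
  "gamma_bar G \<gamma> =
     (\<lambda>y\<in>carrier G. \<gamma> (inv\<^bsub>G\<^esub> y) \<otimes>\<^bsub>aut_group G\<^esub> inner_aut G (inv\<^bsub>G\<^esub> y))"

(* The subgroup generated by the commutators [x, delta y] = x^-1 x^(delta y). *)
definition comm_subgroup :: "('a, 'b) monoid_scheme \<Rightarrow> ('a \<Rightarrow> 'a \<Rightarrow> 'a) \<Rightarrow> 'a set" where
  "comm_subgroup G \<delta> =
     generate G {inv\<^bsub>G\<^esub> x \<otimes>\<^bsub>G\<^esub> \<delta> y x | x y. x \<in> carrier G \<and> y \<in> carrier G}"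

definition anti_hom :: "('a, 'b) monoid_scheme \<Rightarrow> ('a \<Rightarrow> 'a \<Rightarrow> 'a) \<Rightarrow> bool" where
  "anti_hom G \<gamma> \<longleftrightarrow>
     (\<forall>x\<in>carrier G. \<forall>y\<in>carrier G. \<gamma> (x \<otimes>\<^bsub>G\<^esub> y) = \<gamma> y \<otimes>\<^bsub>aut_group G\<^esub> \<gamma> x)"

definition conj_equivariant :: "('a, 'b) monoid_scheme \<Rightarrow> ('a \<Rightarrow> 'a \<Rightarrow> 'a) \<Rightarrow> bool" where
  "conj_equivariant G \<gamma> \<longleftrightarrow>
     (\<forall>x\<in>carrier G. \<forall>y\<in>carrier G. \<gamma> (\<gamma> y x) = conj_by (aut_group G) (\<gamma> x) (\<gamma> y))"

end

theory Submission
  imports Defs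
begin

text \<open>
  For a gamma function \<open>\<gamma>\<close> with circle operation \<open>x \<circ> y = x\<^bsup>\<gamma>(y)\<^esup> y\<close>, the
  map \<open>\<gamma>\<close> is a homomorphism from the circle group to the automorphism group. Both the second brace
  law and the normalisation of \<open>N\<close> by \<open>\<rho>(G)\<close> say that \<open>(x \<circ> y) z = (x z) \<circ> w\<close> for
  the element \<open>w\<close> with \<open>y z = z \<circ> w\<close>; cancelling, this is \<open>\<gamma>(w) = \<gamma>(y)\<close>, that is,
  \<open>\<gamma>(y z) = \<gamma>(z) \<gamma>(y)\<close>. The remaining conditions are compared with this one through
  \<open>x \<circ> y = (y x) k\<close>, where \<open>k = x\<^sup>-\<^sup>1 y\<^sup>-\<^sup>1 x\<^bsup>\<gamma>(y)\<^esup> y\<close>, and through the fact that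
  \<open>u k = u \<circ> k\<close> whenever \<open>\<gamma>(k) = 1\<close>.
\<close>

section \<open>Permutation groups with left-to-right products, and their normalizers\<close>

lemma carrier_perm_group [simp]: "carrier (perm_group S) = Bij S"
  by (simp add: perm_group_def BijGroup_def)

lemma one_perm_group [simp]: "\<one>\<^bsub>perm_group S\<^esub> = (\<lambda>x\<in>S. x)"
  by (simp add: perm_group_def BijGroup_def)

lemma mult_perm_group:
  "f \<in> Bij S \<Longrightarrow> g \<in> Bij S \<Longrightarrow> f \<otimes>\<^bsub>perm_group S\<^esub> g = compose S g f"
  by (simp add: perm_group_def BijGroup_def)

lemma mult_perm_group_apply:
  "f \<in> Bij S \<Longrightarrow> g \<in> Bij S \<Longrightarrow> x \<in> S \<Longrightarrow> (f \<otimes>\<^bsub>perm_group S\<^esub> g) x = g (f x)"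
  by (simp add: mult_perm_group compose_def)

lemma Bij_ext:
  "f \<in> Bij S \<Longrightarrow> g \<in> Bij S \<Longrightarrow> (\<And>x. x \<in> S \<Longrightarrow> f x = g x) \<Longrightarrow> f = g"
  by (auto simp: Bij_def intro: extensionalityI)

lemma Bij_closed: "f \<in> Bij S \<Longrightarrow> x \<in> S \<Longrightarrow> f x \<in> S"
  by (rule funcset_mem[OF Bij_imp_funcset])

lemma Bij_surj:
  assumes "f \<in> Bij S" "y \<in> S" obtains x where "x \<in> S" "f x = y"
proof -
  have "y \<in> f ` S"
    using assms by (simp add: Bij_def bij_betw_def)
  then show ?thesis
    using that by blast
qed

lemma compose_inv_into_Bij:
  "f \<in> Bij S \<Longrightarrow> compose S f (restrict (inv_into S f) S) = (\<lambda>x\<in>S. x)"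
  by (auto simp: Bij_def compose_def bij_betw_inv_into_right)

lemma group_perm_group: "group (perm_group S)"
proof (rule groupI)
  fix x y z
  assume "x \<in> carrier (perm_group S)" "y \<in> carrier (perm_group S)" "z \<in> carrier (perm_group S)"
  then show "x \<otimes>\<^bsub>perm_group S\<^esub> y \<otimes>\<^bsub>perm_group S\<^esub> z = x \<otimes>\<^bsub>perm_group S\<^esub> (y \<otimes>\<^bsub>perm_group S\<^esub> z)"
    by (auto simp: mult_perm_group compose_Bij compose_assoc Bij_imp_funcset)
next
  fix f assume "f \<in> carrier (perm_group S)"
  then have f: "f \<in> Bij S"
    by simp
  show "\<one>\<^bsub>perm_group S\<^esub> \<otimes>\<^bsub>perm_group S\<^esub> f = f"
    using f Bij_imp_funcset[OF f] Bij_imp_extensional[OF f]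
    by (simp add: mult_perm_group id_Bij compose_Id)
  show "\<exists>g\<in>carrier (perm_group S). g \<otimes>\<^bsub>perm_group S\<^esub> f = \<one>\<^bsub>perm_group S\<^esub>"
    using f by (intro bexI[of _ "restrict (inv_into S f) S"])
      (simp_all add: mult_perm_group restrict_inv_into_Bij compose_inv_into_Bij)
qed (simp_all add: mult_perm_group compose_Bij id_Bij)

text \<open>Reversing the order of multiplication does not change inverses, so closure of
  \<open>auto G\<close> under inversion can be transferred from \<open>BijGroup\<close>.\<close>

lemma inv_perm_group:
  assumes "f \<in> Bij S" shows "inv\<^bsub>perm_group S\<^esub> f = inv\<^bsub>BijGroup S\<^esub> f"
proof (rule group.inv_equality[OF group_perm_group])
  show "inv\<^bsub>BijGroup S\<^esub> f \<otimes>\<^bsub>perm_group S\<^esub> f = \<one>\<^bsub>perm_group S\<^esub>"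
    using assms
    by (simp add: inv_BijGroup mult_perm_group restrict_inv_into_Bij compose_inv_into_Bij)
qed (use assms in \<open>auto simp: inv_BijGroup restrict_inv_into_Bij\<close>)

text \<open>The normalizer is the stabilizer of H under conjugation, so membership is the set
  equality g H g^-1 = H, split here into its two inclusions. For a single g and infinite H, one
  inclusion may fail to give the other.\<close>

lemma (in group) mem_normalizer_iff:
  assumes "H \<subseteq> carrier G"
  shows "g \<in> normalizer G H \<longleftrightarrow> g \<in> carrier G \<and>
    (\<forall>h\<in>H. \<exists>k\<in>H. g \<otimes> h = k \<otimes> g) \<and> (\<forall>k\<in>H. \<exists>h\<in>H. g \<otimes> h = k \<otimes> g)"
proof (cases "g \<in> carrier G")
  case True
  have conj: "g \<otimes> h \<otimes> inv g = k \<longleftrightarrow> g \<otimes> h = k \<otimes> g" if "h \<in> H" "k \<in> H" for h k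
    using that assms True by (metis in_mono inv_solve_right m_closed)
  have "g <#\<^bsub>G\<^esub> H #>\<^bsub>G\<^esub> inv g = (\<lambda>h. g \<otimes> h \<otimes> inv g) ` H"
    by (auto simp: l_coset_def r_coset_def)
  then have "g \<in> normalizer G H \<longleftrightarrow> (\<lambda>h. g \<otimes> h \<otimes> inv g) ` H = H"
    using True assms by (simp add: normalizer_def stabilizer_def)
  also have "\<dots> \<longleftrightarrow> (\<forall>h\<in>H. \<exists>k\<in>H. g \<otimes> h \<otimes> inv g = k) \<and> (\<forall>k\<in>H. \<exists>h\<in>H. g \<otimes> h \<otimes> inv g = k)"
    by (auto simp: image_iff set_eq_iff) metis+
  also have "\<dots> \<longleftrightarrow> (\<forall>h\<in>H. \<exists>k\<in>H. g \<otimes> h = k \<otimes> g) \<and> (\<forall>k\<in>H. \<exists>h\<in>H. g \<otimes> h = k \<otimes> g)"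
    by (intro arg_cong2[of _ _ _ _ "(\<and>)"] ball_cong bex_cong refl conj)
  finally show ?thesis
    using True by simp
qed (simp add: normalizer_def stabilizer_def)

text \<open>Products apply the left factor first, so g h = k g means h (g x) = g (k x) at every
  point. This form serves both the holomorph and the subgroup attached to a gamma function.\<close>

lemma mem_normalizer_perm_group_iff:
  assumes H: "H \<subseteq> Bij S"
  shows "g \<in> normalizer (perm_group S) H \<longleftrightarrow> g \<in> Bij S \<and>
    (\<forall>h\<in>H. \<exists>k\<in>H. \<forall>x\<in>S. h (g x) = g (k x)) \<and> (\<forall>k\<in>H. \<exists>h\<in>H. \<forall>x\<in>S. h (g x) = g (k x))"
proof (cases "g \<in> Bij S")
  case True
  have "g \<otimes>\<^bsub>perm_group S\<^esub> h = k \<otimes>\<^bsub>perm_group S\<^esub> g \<longleftrightarrow> (\<forall>x\<in>S. h (g x) = g (k x))"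
    if "h \<in> H" "k \<in> H" for h k
  proof -
    have "h \<in> Bij S" "k \<in> Bij S"
      using H that by auto
    then show ?thesis
      using True by (auto simp: mult_perm_group compose_def restrict_def fun_eq_iff)
  qed
  then have "(\<forall>h\<in>H. \<exists>k\<in>H. g \<otimes>\<^bsub>perm_group S\<^esub> h = k \<otimes>\<^bsub>perm_group S\<^esub> g) \<and>
      (\<forall>k\<in>H. \<exists>h\<in>H. g \<otimes>\<^bsub>perm_group S\<^esub> h = k \<otimes>\<^bsub>perm_group S\<^esub> g) \<longleftrightarrow>
    (\<forall>h\<in>H. \<exists>k\<in>H. \<forall>x\<in>S. h (g x) = g (k x)) \<and> (\<forall>k\<in>H. \<exists>h\<in>H. \<forall>x\<in>S. h (g x) = g (k x))"
    by (intro arg_cong2[of _ _ _ _ "(\<and>)"] ball_cong bex_cong refl)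
  then show ?thesis
    using True H by (simp only: group.mem_normalizer_iff[OF group_perm_group] carrier_perm_group)
qed (simp add: group.mem_normalizer_iff[OF group_perm_group] H)

section \<open>Automorphisms, the holomorph, and gamma functions from families of
  translations\<close>

context group
begin

lemma auto_imp_Bij: "f \<in> auto G \<Longrightarrow> f \<in> Bij (carrier G)"
  by (simp add: auto_def)

lemma auto_imp_hom: "f \<in> auto G \<Longrightarrow> f \<in> hom G G"
  by (simp add: auto_def)

lemma auto_closed [simp]: "f \<in> auto G \<Longrightarrow> x \<in> carrier G \<Longrightarrow> f x \<in> carrier G"
  by (simp add: auto_imp_Bij Bij_closed)

lemma auto_mult:
  "f \<in> auto G \<Longrightarrow> x \<in> carrier G \<Longrightarrow> y \<in> carrier G \<Longrightarrow> f (x \<otimes> y) = f x \<otimes> f y"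
  by (rule hom_mult[OF auto_imp_hom])

lemma auto_one [simp]: "f \<in> auto G \<Longrightarrow> f \<one> = \<one>"
  by (rule hom_one[OF auto_imp_hom is_group is_group])

lemma auto_ext:
  "f \<in> auto G \<Longrightarrow> g \<in> auto G \<Longrightarrow> (\<And>x. x \<in> carrier G \<Longrightarrow> f x = g x) \<Longrightarrow> f = g"
  by (rule Bij_ext[of _ "carrier G"]) (simp_all add: auto_imp_Bij)

lemma autoI:
  assumes "f \<in> Bij (carrier G)"
    and "\<And>x y. x \<in> carrier G \<Longrightarrow> y \<in> carrier G \<Longrightarrow> f (x \<otimes> y) = f x \<otimes> f y"
  shows "f \<in> auto G"
proof -
  have "f \<in> hom G G"
    using Bij_closed[OF assms(1)] assms(2) by (rule homI)
  then show ?thesis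
    using assms(1) by (simp add: auto_def)
qed

lemma subgroup_auto_perm_group: "subgroup (auto G) (perm_group (carrier G))"
proof -
  interpret B: subgroup "auto G" "BijGroup (carrier G)"
    by (rule subgroup_auto)
  show ?thesis
  proof
    show "x \<otimes>\<^bsub>perm_group (carrier G)\<^esub> y \<in> auto G" if "x \<in> auto G" "y \<in> auto G" for x y
      using B.m_closed[OF that(2,1)] by (simp add: perm_group_def)
    show "inv\<^bsub>perm_group (carrier G)\<^esub> x \<in> auto G" if "x \<in> auto G" for x
      using B.m_inv_closed[OF that] that by (simp add: inv_perm_group auto_imp_Bij)
  qed (auto simp: auto_imp_Bij id_in_auto)
qed

lemma group_aut_group: "group (aut_group G)"
  unfolding aut_group_def
  by (rule subgroup.subgroup_is_group[OF subgroup_auto_perm_group group_perm_group])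

lemma carrier_aut_group [simp]: "carrier (aut_group G) = auto G"
  by (simp add: aut_group_def)

lemma one_aut_group_apply [simp]: "x \<in> carrier G \<Longrightarrow> \<one>\<^bsub>aut_group G\<^esub> x = x"
  by (simp add: aut_group_def perm_group_def BijGroup_def)

lemma one_aut_group_closed [simp]: "\<one>\<^bsub>aut_group G\<^esub> \<in> auto G"
  using monoid.one_closed[OF group.is_monoid[OF group_aut_group]] by simp

lemma inv_aut_group_closed [simp]: "f \<in> auto G \<Longrightarrow> inv\<^bsub>aut_group G\<^esub> f \<in> auto G"
  using group.inv_closed[OF group_aut_group] by simp

lemma mult_aut_group_closed [simp]:
  "f \<in> auto G \<Longrightarrow> g \<in> auto G \<Longrightarrow> f \<otimes>\<^bsub>aut_group G\<^esub> g \<in> auto G"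
  using monoid.m_closed[OF group.is_monoid[OF group_aut_group]] by simp

lemma mult_aut_group_apply [simp]:
  "f \<in> auto G \<Longrightarrow> g \<in> auto G \<Longrightarrow> x \<in> carrier G \<Longrightarrow> (f \<otimes>\<^bsub>aut_group G\<^esub> g) x = g (f x)"
  by (simp add: aut_group_def mult_perm_group_apply auto_imp_Bij)

lemma right_mult_surj:
  assumes "g \<in> carrier G" "x \<in> carrier G"
  shows "x \<in> (\<lambda>y. y \<otimes> g) ` carrier G"
  by (rule image_eqI[of _ _ "x \<otimes> inv g"]) (use assms in \<open>simp_all add: m_assoc\<close>)

lemma right_reg_Bij [simp]: "g \<in> carrier G \<Longrightarrow> right_reg G g \<in> Bij (carrier G)"
  by (auto simp: right_reg_def Bij_def bij_betw_def inj_on_def right_mult_surj)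

lemma right_reg_apply [simp]: "x \<in> carrier G \<Longrightarrow> right_reg G g x = x \<otimes> g"
  by (simp add: right_reg_def)

text \<open>Normalizing the right translations means that translating by z after f agrees with
  translating by a suitable w before f. Evaluation at \<open>\<one>\<close> forces z to be the
  inverse of \<open>f \<one>\<close> times \<open>f w\<close>, and substituting this yields the law.
  It has the shape of the brace law with \<open>f \<one>\<close> as the acting element.\<close>

lemma mem_holomorph_iff:
  "f \<in> holomorph G \<longleftrightarrow> f \<in> Bij (carrier G) \<and>
    (\<forall>x\<in>carrier G. \<forall>y\<in>carrier G. f (x \<otimes> y) = f x \<otimes> inv (f \<one>) \<otimes> f y)"
  (is "_ \<longleftrightarrow> _ \<and> ?law")
proof (cases "f \<in> Bij (carrier G)")
  case True
  have sub: "right_reg G ` carrier G \<subseteq> Bij (carrier G)"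
    by auto
  have c [simp]: "f x \<in> carrier G" if "x \<in> carrier G" for x
    using True that by (rule Bij_closed)
  have "f \<in> holomorph G \<longleftrightarrow>
      (\<forall>z\<in>carrier G. \<exists>w\<in>carrier G. \<forall>x\<in>carrier G. f x \<otimes> z = f (x \<otimes> w)) \<and>
      (\<forall>w\<in>carrier G. \<exists>z\<in>carrier G. \<forall>x\<in>carrier G. f x \<otimes> z = f (x \<otimes> w))"
    using True by (simp add: holomorph_def mem_normalizer_perm_group_iff[OF sub])
  also have "\<dots> \<longleftrightarrow> ?law"
  proof (intro iffI conjI ballI)
    fix x y assume xy: "x \<in> carrier G" "y \<in> carrier G" and
      "(\<forall>z\<in>carrier G. \<exists>w\<in>carrier G. \<forall>x\<in>carrier G. f x \<otimes> z = f (x \<otimes> w)) \<and>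
      (\<forall>w\<in>carrier G. \<exists>z\<in>carrier G. \<forall>x\<in>carrier G. f x \<otimes> z = f (x \<otimes> w))"
    then obtain z where z: "z \<in> carrier G" "\<And>x. x \<in> carrier G \<Longrightarrow> f x \<otimes> z = f (x \<otimes> y)"
      by blast
    have "f \<one> \<otimes> z = f y"
      using z(2)[of \<one>] xy by simp
    then have "inv (f \<one>) \<otimes> f y = z"
      using xy z(1) by (metis c inv_solve_left one_closed)
    then show "f (x \<otimes> y) = f x \<otimes> inv (f \<one>) \<otimes> f y"
      using xy z by (simp add: m_assoc)
  next
    fix z assume law: ?law and z: "z \<in> carrier G"
    \<comment> \<open>Surjectivity of f enters here: w has to be a preimage of
      \<open>f \<one> \<otimes> z\<close>.\<close>
    obtain w where w: "w \<in> carrier G" "f w = f \<one> \<otimes> z"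
      using Bij_surj[OF True] z c by (metis m_closed one_closed)
    have "f x \<otimes> z = f (x \<otimes> w)" if "x \<in> carrier G" for x
      using that w z law by (simp add: m_assoc flip: m_assoc[of "inv (f \<one>)"])
    with w show "\<exists>w\<in>carrier G. \<forall>x\<in>carrier G. f x \<otimes> z = f (x \<otimes> w)"
      by blast
  next
    fix w assume law: ?law and w: "w \<in> carrier G"
    then show "\<exists>z\<in>carrier G. \<forall>x\<in>carrier G. f x \<otimes> z = f (x \<otimes> w)"
      by (intro bexI[of _ "inv (f \<one>) \<otimes> f w"]) (auto simp: m_assoc)
  qed
  finally show ?thesis
    using True by simp
qed (simp add: holomorph_def mem_normalizer_perm_group_iff image_subset_iff)

text \<open>Multiplying the law on the right by the inverse of g turns it into multiplicativity.
  Bijectivity survives because f is only composed with a right translation.\<close>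

lemma translate_auto:
  assumes f: "f \<in> Bij (carrier G)" and g: "g \<in> carrier G"
    and law: "\<And>x y. x \<in> carrier G \<Longrightarrow> y \<in> carrier G \<Longrightarrow> f (x \<otimes> y) = f x \<otimes> inv g \<otimes> f y"
  shows "(\<lambda>x\<in>carrier G. f x \<otimes> inv g) \<in> auto G"
proof (rule autoI)
  have c: "f x \<in> carrier G" if "x \<in> carrier G" for x
    using f that by (rule Bij_closed)
  have "(\<lambda>x\<in>carrier G. f x \<otimes> inv g) = compose (carrier G) (right_reg G (inv g)) f"
    using c by (auto simp: compose_def)
  then show "(\<lambda>x\<in>carrier G. f x \<otimes> inv g) \<in> Bij (carrier G)"
    using f g by (simp add: compose_Bij)
  show "(\<lambda>x\<in>carrier G. f x \<otimes> inv g) (x \<otimes> y)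
      = (\<lambda>x\<in>carrier G. f x \<otimes> inv g) x \<otimes> (\<lambda>x\<in>carrier G. f x \<otimes> inv g) y"
    if "x \<in> carrier G" "y \<in> carrier G" for x y
    using that g c by (simp add: law m_assoc)
qed

end

text \<open>Common core of the surjectivity of both correspondences. With \<open>\<nu> y\<close>
  read as the circle translation by y, \<open>law\<close> is the brace law and \<open>assoc\<close>
  is associativity, so one construction serves a given operation and a given regular
  subgroup.\<close>

lemma (in group) gamma_function_of_translations:
  assumes \<nu>: "\<And>y. y \<in> carrier G \<Longrightarrow> \<nu> y \<in> Bij (carrier G)"
    and law: "\<And>x y z. x \<in> carrier G \<Longrightarrow> y \<in> carrier G \<Longrightarrow> z \<in> carrier G \<Longrightarrow>
      \<nu> z (x \<otimes> y) = \<nu> z x \<otimes> inv z \<otimes> \<nu> z y"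
    and assoc: "\<And>x y z. x \<in> carrier G \<Longrightarrow> y \<in> carrier G \<Longrightarrow> z \<in> carrier G \<Longrightarrow>
      \<nu> (\<nu> z y) x = \<nu> z (\<nu> y x)"
  obtains \<gamma> where "\<gamma> \<in> gamma_functions G"
    and "\<And>x y. x \<in> carrier G \<Longrightarrow> y \<in> carrier G \<Longrightarrow> \<gamma> y x \<otimes> y = \<nu> y x"
proof
  define \<gamma> where "\<gamma> = (\<lambda>y\<in>carrier G. \<lambda>x\<in>carrier G. \<nu> y x \<otimes> inv y)"
  have c: "\<nu> y x \<in> carrier G" if "x \<in> carrier G" "y \<in> carrier G" for x y
    using \<nu> that by (simp add: Bij_closed)
  have auto: "\<gamma> y \<in> auto G" if "y \<in> carrier G" for y
    unfolding \<gamma>_def using that translate_auto[OF \<nu>] law by simp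
  show \<gamma>\<nu>: "\<gamma> y x \<otimes> y = \<nu> y x" if "x \<in> carrier G" "y \<in> carrier G" for x y
    using that c by (simp add: \<gamma>_def m_assoc)
  show "\<gamma> \<in> gamma_functions G"
    unfolding gamma_functions_def
  proof (intro CollectI conjI ballI)
    show "\<gamma> \<in> carrier G \<rightarrow>\<^sub>E auto G"
      using auto by (auto simp: \<gamma>_def)
    fix g h assume gh: "g \<in> carrier G" "h \<in> carrier G"
    show "\<gamma> (\<gamma> h g \<otimes> h) = \<gamma> g \<otimes>\<^bsub>aut_group G\<^esub> \<gamma> h"
    proof (rule auto_ext)
      fix x assume x: "x \<in> carrier G"
      \<comment> \<open>The two automorphisms are compared after multiplication on the right by the
        circle product of g and h. The identity then becomes associativity, and the common factor
        cancels.\<close>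
      have "\<gamma> (\<gamma> h g \<otimes> h) x \<otimes> (\<gamma> h g \<otimes> h) = \<nu> h (\<nu> g x)"
        using gh x c by (simp add: \<gamma>\<nu> assoc)
      also have "\<dots> = \<gamma> h (\<gamma> g x \<otimes> g) \<otimes> h"
        using gh x c by (simp add: \<gamma>\<nu>)
      also have "\<dots> = \<gamma> h (\<gamma> g x) \<otimes> (\<gamma> h g \<otimes> h)"
        using gh x auto by (simp add: auto_mult m_assoc)
      finally show "\<gamma> (\<gamma> h g \<otimes> h) x = (\<gamma> g \<otimes>\<^bsub>aut_group G\<^esub> \<gamma> h) x"
        using gh x auto by simp
    qed (use gh auto in simp_all)
  qed
qed

section \<open>The circle group and the regular subgroup of a gamma function\<close>

locale gamma_function = group G for G (structure) +
  fixes \<gamma>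
  assumes gamma: "\<gamma> \<in> gamma_functions G"
begin

abbreviation circ (infixl "\<diamondop>" 70)
  where "x \<diamondop> y \<equiv> gamma_op G \<gamma> x y"

abbreviation circ_group
  where "circ_group \<equiv> \<lparr>carrier = carrier G, monoid.mult = gamma_op G \<gamma>, one = \<one>\<rparr>"

abbreviation aut_mult (infixl "\<bullet>" 70)
  where "f \<bullet> g \<equiv> f \<otimes>\<^bsub>aut_group G\<^esub> g"

sublocale Aut: group "aut_group G"
  by (rule group_aut_group)

lemma gamma_auto [simp]: "x \<in> carrier G \<Longrightarrow> \<gamma> x \<in> auto G"
  using gamma by (auto simp: gamma_functions_def)

lemma circ_eq: "x \<in> carrier G \<Longrightarrow> y \<in> carrier G \<Longrightarrow> x \<diamondop> y = \<gamma> y x \<otimes> y"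
  by (simp add: gamma_op_def)

lemma circ_closed [simp]: "x \<in> carrier G \<Longrightarrow> y \<in> carrier G \<Longrightarrow> x \<diamondop> y \<in> carrier G"
  by (simp add: circ_eq)

lemma gamma_circ: "x \<in> carrier G \<Longrightarrow> y \<in> carrier G \<Longrightarrow> \<gamma> (x \<diamondop> y) = \<gamma> x \<bullet> \<gamma> y"
  using gamma by (simp add: gamma_functions_def circ_eq)

lemma gamma_one: "\<gamma> \<one> = \<one>\<^bsub>aut_group G\<^esub>"
proof -
  have "\<one> \<diamondop> \<one> = \<one>"
    by (simp add: circ_eq)
  then have "\<gamma> \<one> \<bullet> \<gamma> \<one> = \<gamma> \<one>"
    using gamma_circ[of \<one> \<one>] by simp
  then show ?thesis
    by simp
qed

lemma circ_one [simp]: "x \<in> carrier G \<Longrightarrow> x \<diamondop> \<one> = x"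
  by (simp add: circ_eq gamma_one)

lemma one_circ [simp]: "x \<in> carrier G \<Longrightarrow> \<one> \<diamondop> x = x"
  by (simp add: circ_eq)

lemma circ_assoc:
  assumes "x \<in> carrier G" "y \<in> carrier G" "z \<in> carrier G"
  shows "x \<diamondop> y \<diamondop> z = x \<diamondop> (y \<diamondop> z)"
proof -
  have "x \<diamondop> (y \<diamondop> z) = (\<gamma> y \<bullet> \<gamma> z) x \<otimes> (y \<diamondop> z)"
    using assms by (simp add: circ_eq[of x] gamma_circ del: mult_aut_group_apply)
  then show ?thesis
    using assms by (simp add: circ_eq auto_mult m_assoc)
qed

text \<open>The brace law is the multiplicativity of \<open>\<gamma> z\<close> in disguise, because
  the map taking x to \<open>(x \<diamondop> z) \<otimes> inv z\<close> is \<open>\<gamma> z\<close>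
  itself.\<close>

lemma circ_mult_distrib:
  assumes "x \<in> carrier G" "y \<in> carrier G" "z \<in> carrier G"
  shows "(x \<otimes> y) \<diamondop> z = (x \<diamondop> z) \<otimes> inv z \<otimes> (y \<diamondop> z)"
proof -
  have "(x \<diamondop> z) \<otimes> inv z = \<gamma> z x"
    using assms by (simp add: circ_eq m_assoc)
  then show ?thesis
    using assms by (simp add: circ_eq auto_mult m_assoc)
qed

text \<open>The two groups share carrier and identity; the rewrites let the facts of
  \<open>Circ\<close> speak of \<open>carrier G\<close>, \<open>gamma_op G \<gamma>\<close> and
  \<open>\<one>\<close>, so that they combine with facts about G.\<close>

sublocale Circ: group circ_group
  rewrites "carrier circ_group = carrier G"
    and "monoid.mult circ_group = gamma_op G \<gamma>"
    and "one circ_group = \<one>"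
proof -
  show "group circ_group"
  proof (rule groupI; simp add: circ_assoc)
    fix y assume y: "y \<in> carrier G"
    \<comment> \<open>A left inverse has to satisfy
      \<open>\<gamma> y x \<otimes> y = \<one>\<close>, so it is the preimage of
      \<open>inv y\<close> under the bijection \<open>\<gamma> y\<close>.\<close>
    then obtain x where "x \<in> carrier G" "\<gamma> y x = inv y"
      by (metis Bij_surj auto_imp_Bij gamma_auto inv_closed)
    then show "\<exists>x\<in>carrier G. x \<diamondop> y = \<one>"
      using y by (auto simp: circ_eq intro!: bexI[of _ x])
  qed
qed simp_all

lemma skew_brace_circ: "skew_brace G circ_group"
  by unfold_locales (simp_all add: circ_mult_distrib Circ.group_axioms)

lemma gamma_op_mem: "gamma_op G \<gamma> \<in> skew_brace_ops G"
  using skew_brace_circ by (auto simp: skew_brace_ops_def skew_brace_op_def gamma_op_def)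

lemma gamma_extensional: "\<gamma> \<in> extensional (carrier G)"
  using gamma by (simp add: gamma_functions_def PiE_iff)

abbreviation "transl y \<equiv> \<gamma> y \<otimes>\<^bsub>perm_group (carrier G)\<^esub> right_reg G y"

lemma transl_apply [simp]:
  "x \<in> carrier G \<Longrightarrow> y \<in> carrier G \<Longrightarrow> transl y x = x \<diamondop> y"
  by (simp add: mult_perm_group_apply auto_imp_Bij circ_eq)

lemma transl_Bij [simp]: "y \<in> carrier G \<Longrightarrow> transl y \<in> Bij (carrier G)"
  by (simp add: mult_perm_group auto_imp_Bij compose_Bij)

lemma gamma_subgroup_eq_translations: "gamma_subgroup G \<gamma> = op_translations G (gamma_op G \<gamma>)"
proof -
  have "transl y = (\<lambda>x\<in>carrier G. x \<diamondop> y)" if "y \<in> carrier G" for y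
    using that Bij_imp_extensional[OF transl_Bij[OF that]] by (intro extensionalityI) auto
  then show ?thesis
    by (simp add: gamma_subgroup_def op_translations_def)
qed

lemma transl_mult:
  assumes "y \<in> carrier G" "z \<in> carrier G"
  shows "transl y \<otimes>\<^bsub>perm_group (carrier G)\<^esub> transl z = transl (y \<diamondop> z)"
  using assms compose_Bij[of "transl z" "carrier G" "transl y"]
  by (intro Bij_ext[of _ "carrier G"])
    (simp_all add: mult_perm_group[of "transl y" _ "transl z"] compose_def circ_assoc)

lemma transl_one: "transl \<one> = \<one>\<^bsub>perm_group (carrier G)\<^esub>"
  by (rule Bij_ext[of _ "carrier G"]) (simp_all add: id_Bij)

lemma subgroup_gamma_subgroup: "subgroup (gamma_subgroup G \<gamma>) (perm_group (carrier G))"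
proof (rule group.subgroupI[OF group_perm_group])
  show "gamma_subgroup G \<gamma> \<subseteq> carrier (perm_group (carrier G))"
    by (auto simp: gamma_subgroup_def)
  show "gamma_subgroup G \<gamma> \<noteq> {}"
    by (auto simp: gamma_subgroup_def)
next
  fix a assume "a \<in> gamma_subgroup G \<gamma>"
  then obtain y where y: "y \<in> carrier G" "a = transl y"
    by (auto simp: gamma_subgroup_def)
  \<comment> \<open>By \<open>transl_mult\<close> translations multiply as their indices do in the
    circle group, so inverting a translation means taking the circle inverse of its index.\<close>
  define z where "z = inv\<^bsub>circ_group\<^esub> y"
  have z: "z \<in> carrier G" "z \<diamondop> y = \<one>"
    using y Circ.inv_closed Circ.l_inv by (simp_all add: z_def)
  have "inv\<^bsub>perm_group (carrier G)\<^esub> a = transl z"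
    by (rule group.inv_equality[OF group_perm_group]) (use y z in \<open>simp_all add: transl_mult transl_one\<close>)
  then show "inv\<^bsub>perm_group (carrier G)\<^esub> a \<in> gamma_subgroup G \<gamma>"
    using z by (auto simp: gamma_subgroup_def)
next
  fix a b assume "a \<in> gamma_subgroup G \<gamma>" "b \<in> gamma_subgroup G \<gamma>"
  then show "a \<otimes>\<^bsub>perm_group (carrier G)\<^esub> b \<in> gamma_subgroup G \<gamma>"
    by (auto simp: gamma_subgroup_def transl_mult)
qed

text \<open>Regularity is that of the right regular representation of the circle group. Membership
  in the holomorph is the brace law, since \<open>transl z\<close> sends \<open>\<one>\<close> to
  z.\<close>

lemma gamma_subgroup_mem: "gamma_subgroup G \<gamma> \<in> hol_regular_subgroups G"
  unfolding hol_regular_subgroups_def regular_subgroup_def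
proof (intro CollectI conjI ballI subgroup_gamma_subgroup)
  show "gamma_subgroup G \<gamma> \<subseteq> holomorph G"
    by (auto simp: gamma_subgroup_def mem_holomorph_iff circ_mult_distrib)
next
  fix x y assume xy: "x \<in> carrier G" "y \<in> carrier G"
  define z where "z = inv\<^bsub>circ_group\<^esub> x \<diamondop> y"
  have "z \<in> carrier G" "x \<diamondop> z = y"
    using xy by (simp_all add: z_def Circ.inv_solve_left flip: circ_assoc)
  then show "\<exists>\<nu>\<in>gamma_subgroup G \<gamma>. \<nu> x = y"
    using xy by (auto simp: gamma_subgroup_def intro!: bexI[of _ z])
next
  fix x assume x: "x \<in> carrier G"
  have "\<nu> = \<one>\<^bsub>perm_group (carrier G)\<^esub>" if \<nu>: "\<nu> \<in> gamma_subgroup G \<gamma>" "\<nu> x = x" for \<nu>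
  proof -
    obtain y where y: "y \<in> carrier G" "\<nu> = transl y"
      using \<nu>(1) by (auto simp: gamma_subgroup_def)
    then have "y = \<one>"
      using \<nu>(2) x Circ.l_cancel_one[of x y] by simp
    with y show ?thesis
      by (simp only: transl_one)
  qed
  moreover have "\<one>\<^bsub>perm_group (carrier G)\<^esub> \<in> gamma_subgroup G \<gamma>"
    by (rule subgroup.one_closed[OF subgroup_gamma_subgroup])
  moreover have "\<one>\<^bsub>perm_group (carrier G)\<^esub> x = x"
    using x by simp
  ultimately show "{\<nu> \<in> gamma_subgroup G \<gamma>. \<nu> x = x} = {\<one>\<^bsub>perm_group (carrier G)\<^esub>}"
    by blast
qed

end

text \<open>The product of f with the inverse of g fixes x, hence lies in a trivial stabiliser.
  Elements of a regular subgroup can therefore be named by their image of one point.\<close>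

lemma regular_subgroup_unique:
  assumes N: "regular_subgroup N S" and x: "x \<in> S" and "f \<in> N" "g \<in> N" "f x = g x"
  shows "f = g"
proof -
  interpret P: group "perm_group S" by (rule group_perm_group)
  interpret N: subgroup N "perm_group S"
    using N by (simp add: regular_subgroup_def)
  let ?h = "f \<otimes>\<^bsub>perm_group S\<^esub> inv\<^bsub>perm_group S\<^esub> g"
  have B: "f \<in> Bij S" "g \<in> Bij S" "inv\<^bsub>perm_group S\<^esub> g \<in> Bij S"
    using assms N.subset P.inv_closed[of g] by auto
  have "?h x = (inv\<^bsub>perm_group S\<^esub> g) (g x)"
    using B assms(5) x by (simp add: mult_perm_group_apply)
  also have "\<dots> = (g \<otimes>\<^bsub>perm_group S\<^esub> inv\<^bsub>perm_group S\<^esub> g) x"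
    by (rule mult_perm_group_apply[symmetric]) (fact B x)+
  also have "\<dots> = x"
    using B x P.r_inv[of g] by simp
  finally have "?h = \<one>\<^bsub>perm_group S\<^esub>"
    using N x assms(3,4) unfolding regular_subgroup_def by blast
  then show ?thesis
    using B P.inv_solve_right[of "\<one>\<^bsub>perm_group S\<^esub>" f g] P.l_one[of g] P.one_closed
    by (simp del: one_perm_group)
qed

section \<open>The two bijective correspondences, and condition (5)\<close>

context group
begin

lemma gamma_functionI: "\<gamma> \<in> gamma_functions G \<Longrightarrow> gamma_function G \<gamma>"
  by unfold_locales

lemma inj_on_gamma_op: "inj_on (gamma_op G) (gamma_functions G)"
proof
  fix \<gamma> \<delta> assume mem: "\<gamma> \<in> gamma_functions G" "\<delta> \<in> gamma_functions G"
    and eq: "gamma_op G \<gamma> = gamma_op G \<delta>"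
  interpret \<gamma>: gamma_function G \<gamma> by unfold_locales (rule mem)
  interpret \<delta>: gamma_function G \<delta> by unfold_locales (rule mem)
  show "\<gamma> = \<delta>"
  proof (rule extensionalityI[OF \<gamma>.gamma_extensional \<delta>.gamma_extensional])
    fix y assume y: "y \<in> carrier G"
    show "\<gamma> y = \<delta> y"
    proof (rule auto_ext)
      fix x assume x: "x \<in> carrier G"
      have "\<gamma> y x \<otimes> y = \<delta> y x \<otimes> y"
        using x y by (simp add: eq flip: \<gamma>.circ_eq \<delta>.circ_eq)
      then show "\<gamma> y x = \<delta> y x"
        using x y by simp
    qed (use y in simp_all)
  qed
qed

lemma bij_betw_gamma_op: "bij_betw (gamma_op G) (gamma_functions G) (skew_brace_ops G)"
  unfolding bij_betw_def
proof (intro conjI inj_on_gamma_op equalityI subsetI)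
  fix f assume "f \<in> gamma_op G ` gamma_functions G"
  then show "f \<in> skew_brace_ops G"
    by (auto intro: gamma_function.gamma_op_mem gamma_functionI)
next
  fix f assume "f \<in> skew_brace_ops G"
  then obtain e where f: "f \<in> carrier G \<rightarrow>\<^sub>E carrier G \<rightarrow>\<^sub>E carrier G"
    and "skew_brace G \<lparr>carrier = carrier G, monoid.mult = f, one = e\<rparr>" (is "skew_brace _ ?M")
    by (auto simp: skew_brace_ops_def skew_brace_op_def)
  then interpret M: skew_brace G ?M by simp
  obtain \<gamma> where \<gamma>: "\<gamma> \<in> gamma_functions G"
    and \<gamma>f: "\<And>x y. x \<in> carrier G \<Longrightarrow> y \<in> carrier G \<Longrightarrow> \<gamma> y x \<otimes> y = (\<lambda>x\<in>carrier G. f x y) x"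
  proof (rule gamma_function_of_translations[of "\<lambda>y. \<lambda>x\<in>carrier G. f x y"])
    show "(\<lambda>x\<in>carrier G. f x y) \<in> Bij (carrier G)" if "y \<in> carrier G" for y
    proof -
      \<comment> \<open>The permutation property of right multiplication is applied to the circle
        group \<open>?M\<close> instead of G.\<close>
      have "right_reg ?M y \<in> Bij (carrier ?M)"
        using that by (intro M.circ.right_reg_Bij) simp
      then show ?thesis
        by (simp add: right_reg_def)
    qed
    fix x y z assume *: "x \<in> carrier G" "y \<in> carrier G" "z \<in> carrier G"
    show "(\<lambda>x\<in>carrier G. f x z) (x \<otimes> y)
        = (\<lambda>x\<in>carrier G. f x z) x \<otimes> inv z \<otimes> (\<lambda>x\<in>carrier G. f x z) y"
      using * M.brace_law[of x y z] by simp
    show "(\<lambda>x\<in>carrier G. f x ((\<lambda>x\<in>carrier G. f x z) y)) x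
        = (\<lambda>x\<in>carrier G. f x z) ((\<lambda>x\<in>carrier G. f x y) x)"
      using * M.circ.m_assoc[of x y z] M.circ.m_closed[of x y] by simp
  qed blast
  \<comment> \<open>Operations are curried and extensional in each argument, so extensionality is
    applied twice.\<close>
  have "f = gamma_op G \<gamma>"
  proof (rule extensionalityI[of _ "carrier G"])
    show "f x = gamma_op G \<gamma> x" if "x \<in> carrier G" for x
    proof (rule extensionalityI[of _ "carrier G"])
      show "f x \<in> extensional (carrier G)"
        using f that by (meson PiE_iff)
    qed (use that \<gamma>f in \<open>auto simp: gamma_op_def\<close>)
  qed (use f in \<open>auto simp: gamma_op_def PiE_iff\<close>)
  with \<gamma> show "f \<in> gamma_op G ` gamma_functions G"
    by blast
qed

lemma inj_on_gamma_subgroup: "inj_on (gamma_subgroup G) (gamma_functions G)"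
proof
  fix \<gamma> \<delta> assume mem: "\<gamma> \<in> gamma_functions G" "\<delta> \<in> gamma_functions G"
    and eq: "gamma_subgroup G \<gamma> = gamma_subgroup G \<delta>"
  interpret \<gamma>: gamma_function G \<gamma> by unfold_locales (rule mem)
  interpret \<delta>: gamma_function G \<delta> by unfold_locales (rule mem)
  have "gamma_op G \<gamma> x y = gamma_op G \<delta> x y" if xy: "x \<in> carrier G" "y \<in> carrier G" for x y
  proof -
    have "\<gamma>.transl y \<in> gamma_subgroup G \<gamma>"
      using xy by (auto simp: gamma_subgroup_def)
    then have "\<gamma>.transl y \<in> gamma_subgroup G \<delta>"
      by (simp only: eq)
    then obtain w where w: "w \<in> carrier G" "\<gamma>.transl y = \<delta>.transl w"
      by (auto simp: gamma_subgroup_def)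
    \<comment> \<open>A translation sends \<open>\<one>\<close> to its index, so equal translations
      have equal indices.\<close>
    have "y = w"
      using xy w(1) fun_cong[OF w(2), of \<one>] by simp
    then show ?thesis
      using xy w(1) fun_cong[OF w(2), of x] by simp
  qed
  then have "gamma_op G \<gamma> = gamma_op G \<delta>"
    by (auto simp: gamma_op_def fun_eq_iff restrict_def)
  then show "\<gamma> = \<delta>"
    using inj_on_gamma_op mem by (simp add: inj_on_eq_iff)
qed

lemma bij_betw_gamma_subgroup:
  "bij_betw (gamma_subgroup G) (gamma_functions G) (hol_regular_subgroups G)"
  unfolding bij_betw_def
proof (intro conjI inj_on_gamma_subgroup equalityI subsetI)
  fix N assume "N \<in> gamma_subgroup G ` gamma_functions G"
  then show "N \<in> hol_regular_subgroups G"
    by (auto intro: gamma_function.gamma_subgroup_mem gamma_functionI)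
next
  fix N assume "N \<in> hol_regular_subgroups G"
  then have hol: "N \<subseteq> holomorph G" and N: "regular_subgroup N (carrier G)"
    by (auto simp: hol_regular_subgroups_def)
  then have sub: "subgroup N (perm_group (carrier G))"
    and "\<forall>y\<in>carrier G. \<exists>f\<in>N. f \<one> = y"
    by (simp_all add: regular_subgroup_def)
  \<comment> \<open>Transitivity supplies, for each y, an element of N taking \<open>\<one>\<close>
    to y, and \<open>\<nu>\<close> chooses one.\<close>
  then obtain \<nu> where \<nu>: "\<And>y. y \<in> carrier G \<Longrightarrow> \<nu> y \<in> N \<and> \<nu> y \<one> = y"
    by metis
  have Bij: "f \<in> Bij (carrier G)" if "f \<in> N" for f
    using hol that by (auto simp: mem_holomorph_iff)
  have c: "\<nu> y x \<in> carrier G" if "x \<in> carrier G" "y \<in> carrier G" for x y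
    using that \<nu> Bij Bij_closed by metis
  obtain \<gamma> where \<gamma>: "\<gamma> \<in> gamma_functions G"
    and \<gamma>\<nu>: "\<And>x y. x \<in> carrier G \<Longrightarrow> y \<in> carrier G \<Longrightarrow> \<gamma> y x \<otimes> y = \<nu> y x"
  proof (rule gamma_function_of_translations[of \<nu>])
    show "\<nu> y \<in> Bij (carrier G)" if "y \<in> carrier G" for y
      using \<nu> that Bij by blast
    fix x y z assume *: "x \<in> carrier G" "y \<in> carrier G" "z \<in> carrier G"
    show "\<nu> z (x \<otimes> y) = \<nu> z x \<otimes> inv z \<otimes> \<nu> z y"
      using * \<nu>[of z] hol by (auto simp: mem_holomorph_iff)
    let ?h = "\<nu> y \<otimes>\<^bsub>perm_group (carrier G)\<^esub> \<nu> z"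
    have h: "?h w = \<nu> z (\<nu> y w)" if "w \<in> carrier G" for w
      using * that \<nu> Bij by (simp add: mult_perm_group_apply)
    \<comment> \<open>Both sides lie in N and send \<open>\<one>\<close> to
      \<open>\<nu> z y\<close>, so regularity identifies them. This is how closure of N under
      products becomes associativity.\<close>
    have "\<nu> (\<nu> z y) = ?h"
      by (rule regular_subgroup_unique[OF N one_closed])
        (use * \<nu> c h subgroup.m_closed[OF sub] in auto)
    with h * show "\<nu> (\<nu> z y) x = \<nu> z (\<nu> y x)"
      by simp
  qed blast
  interpret gamma_function G \<gamma> by unfold_locales (rule \<gamma>)
  have transl: "transl y = \<nu> y" if "y \<in> carrier G" for y
    using that \<nu> Bij by (intro Bij_ext[of _ "carrier G"]) (simp_all add: \<gamma>\<nu> circ_eq)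
  \<comment> \<open>By regularity an element of N is the chosen one with the same value at
    \<open>\<one>\<close>, so the family \<open>\<nu>\<close> exhausts N.\<close>
  moreover have "f = \<nu> (f \<one>)" "f \<one> \<in> carrier G" if "f \<in> N" for f
    using that \<nu> Bij Bij_closed one_closed by (metis regular_subgroup_unique[OF N one_closed])+
  ultimately have "N = gamma_subgroup G \<gamma>"
    using \<nu> by (auto simp: gamma_subgroup_def)
  with \<gamma> show "N \<in> gamma_subgroup G ` gamma_functions G"
    by blast
qed

text \<open>The anti-homomorphism law puts \<open>\<gamma> h\<close> in front of a conjugate whose
  leading factor is the inverse of \<open>\<gamma> h\<close>, and the two cancel. This covers
  condition (5), where \<gamma> is only a function.\<close>

lemma anti_hom_conj_equivariant_imp_gamma_function:
  assumes \<gamma>: "\<gamma> \<in> carrier G \<rightarrow>\<^sub>E auto G" and "anti_hom G \<gamma>" "conj_equivariant G \<gamma>"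
  shows "\<gamma> \<in> gamma_functions G"
proof -
  interpret Aut: group "aut_group G" by (rule group_aut_group)
  have [simp]: "\<gamma> x \<in> auto G" if "x \<in> carrier G" for x
    using \<gamma> that by auto
  have "\<gamma> (\<gamma> h g \<otimes> h) = \<gamma> g \<otimes>\<^bsub>aut_group G\<^esub> \<gamma> h" if "g \<in> carrier G" "h \<in> carrier G" for g h
  proof -
    have "\<gamma> (\<gamma> h g \<otimes> h) = \<gamma> h \<otimes>\<^bsub>aut_group G\<^esub> conj_by (aut_group G) (\<gamma> g) (\<gamma> h)"
      using assms that by (simp add: anti_hom_def conj_equivariant_def)
    then show ?thesis
      using that by (simp add: conj_by_def flip: Aut.m_assoc)
  qed
  with \<gamma> show ?thesis
    by (simp add: gamma_functions_def)
qed

end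

section \<open>Equivalence of each condition with the anti-homomorphism property\<close>

context gamma_function
begin

text \<open>Pivot for the bi-skew brace and for the normalisation, stated for a single pair y, z.
  Leaving w existential matches the normalizer criterion, while x = \<open>\<one>\<close> forces w
  to be the circle inverse of z times \<open>y \<otimes> z\<close>, as in the brace law.\<close>

lemma anti_hom_iff_ex_circ:
  assumes y: "y \<in> carrier G" and z: "z \<in> carrier G"
  shows "\<gamma> (y \<otimes> z) = \<gamma> z \<bullet> \<gamma> y \<longleftrightarrow>
    (\<exists>w\<in>carrier G. \<forall>x\<in>carrier G. (x \<diamondop> y) \<otimes> z = (x \<otimes> z) \<diamondop> w)"
proof
  assume anti: "\<gamma> (y \<otimes> z) = \<gamma> z \<bullet> \<gamma> y"
  define w where "w = inv\<^bsub>circ_group\<^esub> z \<diamondop> (y \<otimes> z)"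
  have w: "w \<in> carrier G" "z \<diamondop> w = y \<otimes> z"
    using y z by (simp_all add: w_def flip: circ_assoc)
  have "\<gamma> z \<bullet> \<gamma> w = \<gamma> z \<bullet> \<gamma> y"
    using y z w anti by (simp flip: gamma_circ)
  then have "\<gamma> w = \<gamma> y"
    using y z w by simp
  then have "(x \<diamondop> y) \<otimes> z = (x \<otimes> z) \<diamondop> w" if "x \<in> carrier G" for x
    using that y z w(1) w(2)[symmetric] by (simp add: circ_eq auto_mult m_assoc)
  with w show "\<exists>w\<in>carrier G. \<forall>x\<in>carrier G. (x \<diamondop> y) \<otimes> z = (x \<otimes> z) \<diamondop> w"
    by blast
next
  assume "\<exists>w\<in>carrier G. \<forall>x\<in>carrier G. (x \<diamondop> y) \<otimes> z = (x \<otimes> z) \<diamondop> w"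
  then obtain w where w: "w \<in> carrier G"
    "\<And>x. x \<in> carrier G \<Longrightarrow> (x \<diamondop> y) \<otimes> z = (x \<otimes> z) \<diamondop> w"
    by blast
  have yz: "y \<otimes> z = z \<diamondop> w"
    using w(2)[of \<one>] y z by simp
  have "\<gamma> y = \<gamma> w"
  proof (rule auto_ext)
    fix x assume x: "x \<in> carrier G"
    \<comment> \<open>On both sides the factors after the image of x collapse to
      \<open>y \<otimes> z\<close>, which is then cancelled.\<close>
    have "\<gamma> y x \<otimes> (y \<otimes> z) = \<gamma> w x \<otimes> (z \<diamondop> w)"
      using w(2)[OF x] w(1) x y z by (simp add: circ_eq auto_mult m_assoc)
    then show "\<gamma> y x = \<gamma> w x"
      using x y z w(1) by (simp add: yz)
  qed (use y w in simp_all)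
  then show "\<gamma> (y \<otimes> z) = \<gamma> z \<bullet> \<gamma> y"
    using y z w(1) by (simp add: yz gamma_circ)
qed

lemma bi_skew_brace_iff_anti_hom: "bi_skew_brace_op G (gamma_op G \<gamma>) \<longleftrightarrow> anti_hom G \<gamma>"
proof
  assume "bi_skew_brace_op G (gamma_op G \<gamma>)"
  then obtain e where
    "skew_brace \<lparr>carrier = carrier G, monoid.mult = gamma_op G \<gamma>, one = e\<rparr> G"
    (is "skew_brace ?M _")
    by (auto simp: bi_skew_brace_op_def)
  then interpret M: skew_brace ?M G .
  show "anti_hom G \<gamma>"
    unfolding anti_hom_def
  proof (intro ballI)
    fix y z assume yz: "y \<in> carrier G" "z \<in> carrier G"
    \<comment> \<open>This inverse is taken in \<open>?M\<close>, whose identity is the unspecified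
      e, so its closure comes from the interpretation \<open>M\<close>.\<close>
    have i: "inv\<^bsub>?M\<^esub> z \<in> carrier G"
      using M.add.inv_closed[of z] yz by simp
    \<comment> \<open>Associativity regroups the right side of the second brace law, so that its
      last two factors form the witness w.\<close>
    have "(x \<diamondop> y) \<otimes> z = (x \<otimes> z) \<diamondop> (inv\<^bsub>?M\<^esub> z \<diamondop> (y \<otimes> z))"
      if "x \<in> carrier G" for x
      using M.brace_law[of x y z] that yz i by (simp add: circ_assoc)
    then show "\<gamma> (y \<otimes> z) = \<gamma> z \<bullet> \<gamma> y"
      using yz i by (subst anti_hom_iff_ex_circ) (auto intro!: bexI[of _ "inv\<^bsub>?M\<^esub> z \<diamondop> (y \<otimes> z)"])
  qed
next
  assume anti: "anti_hom G \<gamma>"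
  have "skew_brace circ_group G"
  proof
    fix x y z
    assume "x \<in> carrier circ_group" "y \<in> carrier circ_group" "z \<in> carrier circ_group"
    then have *: "x \<in> carrier G" "y \<in> carrier G" "z \<in> carrier G"
      by simp_all
    then obtain w where w: "w \<in> carrier G"
      "\<And>x. x \<in> carrier G \<Longrightarrow> (x \<diamondop> y) \<otimes> z = (x \<otimes> z) \<diamondop> w"
      using anti anti_hom_iff_ex_circ[of y z] by (auto simp: anti_hom_def)
    have "z \<diamondop> w = y \<otimes> z"
      using w(2)[of \<one>] * by simp
    then have "w = inv\<^bsub>circ_group\<^esub> z \<diamondop> (y \<otimes> z)"
      using * w(1) by (simp add: Circ.inv_solve_left)
    then show "(x \<otimes>\<^bsub>circ_group\<^esub> y) \<otimes> z
        = (x \<otimes> z) \<otimes>\<^bsub>circ_group\<^esub> inv\<^bsub>circ_group\<^esub> z \<otimes>\<^bsub>circ_group\<^esub> (y \<otimes> z)"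
      using * w by (simp add: circ_assoc)
  qed simp
  then show "bi_skew_brace_op G (gamma_op G \<gamma>)"
    using skew_brace_circ by (auto simp: bi_skew_brace_op_def)
qed

text \<open>For one translation, normalising amounts to two inclusions, \<open>?A z\<close> and
  \<open>?B z\<close>. The second is the criterion of \<open>anti_hom_iff_ex_circ\<close>; the first
  is the second for the inverse of z, which is available because z ranges over the whole
  group.\<close>

lemma normalised_iff_anti_hom:
  "right_reg G ` carrier G \<subseteq> normalizer (perm_group (carrier G)) (gamma_subgroup G \<gamma>)
    \<longleftrightarrow> anti_hom G \<gamma>"
proof -
  have sub: "gamma_subgroup G \<gamma> \<subseteq> Bij (carrier G)"
    by (auto simp: gamma_subgroup_def)
  have mem: "right_reg G z \<in> normalizer (perm_group (carrier G)) (gamma_subgroup G \<gamma>) \<longleftrightarrow>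
    (\<forall>y\<in>carrier G. \<exists>w\<in>carrier G. \<forall>x\<in>carrier G. (x \<otimes> z) \<diamondop> y = (x \<diamondop> w) \<otimes> z) \<and>
    (\<forall>y\<in>carrier G. \<exists>w\<in>carrier G. \<forall>x\<in>carrier G. (x \<diamondop> y) \<otimes> z = (x \<otimes> z) \<diamondop> w)"
    (is "_ \<longleftrightarrow> ?A z \<and> ?B z") if "z \<in> carrier G" for z
  proof -
    have "right_reg G z \<in> normalizer (perm_group (carrier G)) (gamma_subgroup G \<gamma>) \<longleftrightarrow>
      ?A z \<and> (\<forall>y\<in>carrier G. \<exists>w\<in>carrier G. \<forall>x\<in>carrier G. (x \<otimes> z) \<diamondop> w = (x \<diamondop> y) \<otimes> z)"
      using that unfolding mem_normalizer_perm_group_iff[OF sub]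
      by (simp add: gamma_subgroup_def)
    then show ?thesis
      by (simp add: eq_commute)
  qed
  have A: "?A z" if z: "z \<in> carrier G" and B: "?B (inv z)" for z
  proof
    fix y assume y: "y \<in> carrier G"
    then obtain w where w: "w \<in> carrier G"
      "\<And>x. x \<in> carrier G \<Longrightarrow> (x \<diamondop> y) \<otimes> inv z = (x \<otimes> inv z) \<diamondop> w"
      using B by blast
    \<comment> \<open>The condition for the inverse of z is used at \<open>x \<otimes> z\<close>,
      and z is then moved to the other side.\<close>
    have "(x \<otimes> z) \<diamondop> y = (x \<diamondop> w) \<otimes> z" if "x \<in> carrier G" for x
      using w(1) w(2)[of "x \<otimes> z"] that y z by (simp add: m_assoc inv_solve_right')
    with w show "\<exists>w\<in>carrier G. \<forall>x\<in>carrier G. (x \<otimes> z) \<diamondop> y = (x \<diamondop> w) \<otimes> z"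
      by blast
  qed
  have "right_reg G ` carrier G \<subseteq> normalizer (perm_group (carrier G)) (gamma_subgroup G \<gamma>)
      \<longleftrightarrow> (\<forall>z\<in>carrier G. ?A z \<and> ?B z)"
    unfolding image_subset_iff by (intro ball_cong refl mem)
  also have "\<dots> \<longleftrightarrow> (\<forall>z\<in>carrier G. ?B z)"
  proof
    assume *: "\<forall>z\<in>carrier G. ?A z \<and> ?B z"
    show "\<forall>z\<in>carrier G. ?B z"
      by (rule ballI, rule conjunct2, rule bspec[OF *])
  next
    assume B: "\<forall>z\<in>carrier G. ?B z"
    show "\<forall>z\<in>carrier G. ?A z \<and> ?B z"
    proof (rule ballI, rule conjI)
      fix z assume z: "z \<in> carrier G"
      show "?A z"
        by (rule A[OF z bspec[OF B inv_closed[OF z]]])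
      show "?B z"
        by (rule bspec[OF B z])
    qed
  qed
  also have "\<dots> \<longleftrightarrow> anti_hom G \<gamma>"
    by (auto simp: anti_hom_def anti_hom_iff_ex_circ)
  finally show ?thesis .
qed

text \<open>The gamma function law gives the value \<open>\<gamma> x \<bullet> \<gamma> y\<close> at
  \<open>\<gamma> y x \<otimes> y\<close>. Multiplying equivariance on the left by
  \<open>\<gamma> y\<close> therefore turns it into the anti-homomorphism law for the pair
  \<open>\<gamma> y x\<close>, y.\<close>

lemma conj_equivariant_iff_anti_hom: "conj_equivariant G \<gamma> \<longleftrightarrow> anti_hom G \<gamma>"
proof -
  have "\<gamma> (\<gamma> y x) = conj_by (aut_group G) (\<gamma> x) (\<gamma> y) \<longleftrightarrow> \<gamma> (\<gamma> y x \<otimes> y) = \<gamma> y \<bullet> \<gamma> (\<gamma> y x)"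
    if "x \<in> carrier G" "y \<in> carrier G" for x y
  proof -
    have "\<gamma> (\<gamma> y x \<otimes> y) = \<gamma> x \<bullet> \<gamma> y"
      using that gamma_circ by (simp add: circ_eq)
    then show ?thesis
      using that Aut.inv_solve_left[of "\<gamma> (\<gamma> y x)" "\<gamma> y" "\<gamma> x \<bullet> \<gamma> y"] Aut.inv_closed[of "\<gamma> y"]
      by (auto simp: conj_by_def Aut.m_assoc)
  qed
  then have "conj_equivariant G \<gamma> \<longleftrightarrow>
      (\<forall>y\<in>carrier G. \<forall>x\<in>carrier G. \<gamma> (\<gamma> y x \<otimes> y) = \<gamma> y \<bullet> \<gamma> (\<gamma> y x))"
    by (auto simp: conj_equivariant_def)
  \<comment> \<open>Each \<open>\<gamma> y\<close> is onto, so \<open>\<gamma> y x\<close> runs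
    through the whole carrier as x does.\<close>
  also have "\<dots> \<longleftrightarrow> (\<forall>y\<in>carrier G. \<forall>x\<in>carrier G. \<gamma> (x \<otimes> y) = \<gamma> y \<bullet> \<gamma> x)"
    by (metis Bij_surj auto_imp_Bij gamma_auto auto_closed)
  finally show ?thesis
    by (auto simp: anti_hom_def)
qed

text \<open>An anti-homomorphism is a homomorphism into the opposite group, so its kernel is a
  subgroup. This carries triviality of \<gamma> from the commutators to the subgroup they
  generate.\<close>

lemma anti_hom_imp_kernel_subgroup:
  assumes "anti_hom G \<gamma>"
  shows "subgroup {x \<in> carrier G. \<gamma> x = \<one>\<^bsub>aut_group G\<^esub>} G"
proof
  fix x assume "x \<in> {x \<in> carrier G. \<gamma> x = \<one>\<^bsub>aut_group G\<^esub>}"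
  then have x: "x \<in> carrier G" "\<gamma> x = \<one>\<^bsub>aut_group G\<^esub>"
    by auto
  have "\<gamma> (inv x \<otimes> x) = \<gamma> x \<bullet> \<gamma> (inv x)"
    using assms x by (simp only: anti_hom_def inv_closed)
  then show "inv x \<in> {x \<in> carrier G. \<gamma> x = \<one>\<^bsub>aut_group G\<^esub>}"
    using x Aut.l_one[of "\<gamma> (inv x)"] by (simp add: gamma_one)
next
  show "x \<otimes> y \<in> {x \<in> carrier G. \<gamma> x = \<one>\<^bsub>aut_group G\<^esub>}"
    if "x \<in> {x \<in> carrier G. \<gamma> x = \<one>\<^bsub>aut_group G\<^esub>}" "y \<in> {x \<in> carrier G. \<gamma> x = \<one>\<^bsub>aut_group G\<^esub>}"
    for x y
    using assms that Aut.l_one[OF Aut.one_closed]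
    by (simp add: anti_hom_def)
qed (auto simp: gamma_one)

lemma gamma_commutator_iff_anti_hom:
  "(\<forall>x\<in>carrier G. \<forall>y\<in>carrier G.
      \<gamma> (inv x \<otimes> inv y \<otimes> \<gamma> y x \<otimes> y) = \<one>\<^bsub>aut_group G\<^esub>) \<longleftrightarrow> anti_hom G \<gamma>"
proof -
  \<comment> \<open>The disjunction lets one pointwise equivalence prove both directions: whichever
    side is assumed globally provides a way to evaluate \<gamma> at
    \<open>y \<otimes> x \<otimes> k\<close>, either by reversing the product or by reading it as a
    circle product.\<close>
  have "\<gamma> (inv x \<otimes> inv y \<otimes> \<gamma> y x \<otimes> y) = \<one>\<^bsub>aut_group G\<^esub> \<longleftrightarrow> \<gamma> (y \<otimes> x) = \<gamma> x \<bullet> \<gamma> y"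
    if anti: "anti_hom G \<gamma> \<or> \<gamma> (inv x \<otimes> inv y \<otimes> \<gamma> y x \<otimes> y) = \<one>\<^bsub>aut_group G\<^esub>"
      and xy: "x \<in> carrier G" "y \<in> carrier G" for x y
  proof -
    define k where "k = inv x \<otimes> inv y \<otimes> \<gamma> y x \<otimes> y"
    have k: "k \<in> carrier G" "x \<diamondop> y = y \<otimes> x \<otimes> k"
      using xy by (simp_all add: k_def circ_eq m_assoc flip: m_assoc[of x "inv x"] m_assoc[of y "inv y"])
    have "\<gamma> k = \<one>\<^bsub>aut_group G\<^esub> \<longleftrightarrow> \<gamma> (y \<otimes> x) = \<gamma> x \<bullet> \<gamma> y"
      using anti unfolding k_def[symmetric]
    proof
      assume anti: "anti_hom G \<gamma>"
      have "\<gamma> x \<bullet> \<gamma> y = \<gamma> (y \<otimes> x \<otimes> k)"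
        using xy k(2) gamma_circ[of x y] by simp
      also have "\<dots> = \<gamma> k \<bullet> \<gamma> (y \<otimes> x)"
        using anti xy k(1) by (simp add: anti_hom_def)
      finally have "\<gamma> x \<bullet> \<gamma> y = \<gamma> k \<bullet> \<gamma> (y \<otimes> x)" .
      moreover have "\<gamma> (y \<otimes> x) = \<gamma> x \<bullet> \<gamma> y"
        using anti xy by (simp add: anti_hom_def)
      ultimately show ?thesis
        using xy k(1) Aut.r_cancel_one'[of "\<gamma> (y \<otimes> x)" "\<gamma> k"] by simp
    next
      assume 1: "\<gamma> k = \<one>\<^bsub>aut_group G\<^esub>"
      have "y \<otimes> x \<otimes> k = (y \<otimes> x) \<diamondop> k"
        using xy k(1) by (simp add: circ_eq 1)
      then have "\<gamma> x \<bullet> \<gamma> y = \<gamma> (y \<otimes> x) \<bullet> \<gamma> k"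
        using xy k gamma_circ[of x y] gamma_circ[of "y \<otimes> x" k] by simp
      then show ?thesis
        using xy 1 Aut.r_one[of "\<gamma> (y \<otimes> x)"] by simp
    qed
    then show ?thesis
      by (simp only: k_def)
  qed
  then show ?thesis
    by (auto simp: anti_hom_def)
qed

lemma gamma_bar_apply:
  assumes "x \<in> carrier G" "y \<in> carrier G"
  shows "gamma_bar G \<gamma> y x = y \<otimes> \<gamma> (inv y) x \<otimes> inv y"
proof -
  \<comment> \<open>The evaluation rule for products in \<open>aut_group G\<close> applies to
    automorphisms, so the inner factor must first be shown to be one.\<close>
  have "inner_aut G (inv y) \<in> auto G"
  proof (rule autoI)
    show "inner_aut G (inv y) \<in> Bij (carrier G)"
      using assms
      by (auto simp: Bij_def inner_aut_def conj_by_def intro!: bij_betwI[where g = "\<lambda>x. inv y \<otimes> x \<otimes> y"])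
        (simp_all add: m_assoc flip: m_assoc[of y "inv y"] m_assoc[of "inv y" y])
    show "inner_aut G (inv y) (u \<otimes> v) = inner_aut G (inv y) u \<otimes> inner_aut G (inv y) v"
      if "u \<in> carrier G" "v \<in> carrier G" for u v
      using assms that by (simp add: inner_aut_def conj_by_def m_assoc flip: m_assoc[of "inv y" y])
  qed
  then show ?thesis
    using assms by (simp add: gamma_bar_def inner_aut_def conj_by_def)
qed

lemma gamma_comm_subgroup_iff_anti_hom:
  "(\<forall>s\<in>comm_subgroup G (gamma_bar G \<gamma>). \<gamma> s = \<one>\<^bsub>aut_group G\<^esub>) \<longleftrightarrow> anti_hom G \<gamma>"
proof -
  let ?gens = "{inv x \<otimes> gamma_bar G \<gamma> y x | x y. x \<in> carrier G \<and> y \<in> carrier G}"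
  let ?ker = "{x \<in> carrier G. \<gamma> x = \<one>\<^bsub>aut_group G\<^esub>}"
  \<comment> \<open>At the inverse of y, \<open>gamma_bar G \<gamma>\<close> is
    \<open>\<gamma> y\<close> followed by conjugation by y, so these commutators are the elements in
    condition (7).\<close>
  have gen: "inv x \<otimes> gamma_bar G \<gamma> (inv y) x = inv x \<otimes> inv y \<otimes> \<gamma> y x \<otimes> y"
    if "x \<in> carrier G" "y \<in> carrier G" for x y
    using that by (simp add: gamma_bar_apply m_assoc)
  \<comment> \<open>Inversion permutes the carrier, so replacing y by its inverse only reindexes the
    generators.\<close>
  have gens: "?gens = {inv x \<otimes> inv y \<otimes> \<gamma> y x \<otimes> y | x y. x \<in> carrier G \<and> y \<in> carrier G}"
  proof (intro equalityI subsetI)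
    fix s assume "s \<in> ?gens"
    then obtain x y where xy: "x \<in> carrier G" "y \<in> carrier G"
      and s: "s = inv x \<otimes> gamma_bar G \<gamma> y x"
      by auto
    have "s = inv x \<otimes> inv (inv y) \<otimes> \<gamma> (inv y) x \<otimes> inv y"
      using xy gen[of x "inv y"] s by simp
    then show "s \<in> {inv x \<otimes> inv y \<otimes> \<gamma> y x \<otimes> y | x y. x \<in> carrier G \<and> y \<in> carrier G}"
      by (intro CollectI exI[of _ x] exI[of _ "inv y"] conjI inv_closed xy)
  next
    fix s
    assume "s \<in> {inv x \<otimes> inv y \<otimes> \<gamma> y x \<otimes> y | x y. x \<in> carrier G \<and> y \<in> carrier G}"
    then obtain x y where xy: "x \<in> carrier G" "y \<in> carrier G"
      and "s = inv x \<otimes> inv y \<otimes> \<gamma> y x \<otimes> y"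
      by auto
    then have "s = inv x \<otimes> gamma_bar G \<gamma> (inv y) x"
      using gen by simp
    then show "s \<in> ?gens"
      by (intro CollectI exI[of _ x] exI[of _ "inv y"] conjI inv_closed xy)
  qed
  show ?thesis
  proof
    assume *: "\<forall>s\<in>comm_subgroup G (gamma_bar G \<gamma>). \<gamma> s = \<one>\<^bsub>aut_group G\<^esub>"
    show "anti_hom G \<gamma>"
      unfolding gamma_commutator_iff_anti_hom[symmetric]
    proof (intro ballI)
      fix x y assume xy: "x \<in> carrier G" "y \<in> carrier G"
      have "inv x \<otimes> inv y \<otimes> \<gamma> y x \<otimes> y \<in> ?gens"
        unfolding gens by (intro CollectI exI[of _ x] exI[of _ y] conjI refl xy)
      then have "inv x \<otimes> inv y \<otimes> \<gamma> y x \<otimes> y \<in> comm_subgroup G (gamma_bar G \<gamma>)"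
        unfolding comm_subgroup_def by (rule generate.incl)
      then show "\<gamma> (inv x \<otimes> inv y \<otimes> \<gamma> y x \<otimes> y) = \<one>\<^bsub>aut_group G\<^esub>"
        by (rule bspec[OF *])
    qed
  next
    assume anti: "anti_hom G \<gamma>"
    have "?gens \<subseteq> ?ker"
      unfolding gens using iffD2[OF gamma_commutator_iff_anti_hom anti] by auto
    then have "comm_subgroup G (gamma_bar G \<gamma>) \<subseteq> ?ker"
      unfolding comm_subgroup_def
      by (rule generate_subgroup_incl[OF _ anti_hom_imp_kernel_subgroup[OF anti]])
    then show "\<forall>s\<in>comm_subgroup G (gamma_bar G \<gamma>). \<gamma> s = \<one>\<^bsub>aut_group G\<^esub>"
      by (simp add: subset_iff)
  qed
qed

end

theorem theorem3p1:
  fixes G :: "('a, 'b) monoid_scheme"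
  assumes "group G"
  shows
    "bij_betw (gamma_op G) (gamma_functions G) (skew_brace_ops G) \<and>
     bij_betw (gamma_subgroup G) (gamma_functions G) (hol_regular_subgroups G) \<and>
     (\<forall>\<gamma>\<in>gamma_functions G. gamma_subgroup G \<gamma> = op_translations G (gamma_op G \<gamma>)) \<and>
     (\<forall>\<gamma>\<in>gamma_functions G.
        (bi_skew_brace_op G (gamma_op G \<gamma>) \<longleftrightarrow>
           right_reg G ` carrier G
             \<subseteq> normalizer (perm_group (carrier G)) (gamma_subgroup G \<gamma>)) \<and>
        (bi_skew_brace_op G (gamma_op G \<gamma>) \<longleftrightarrow> anti_hom G \<gamma>) \<and>
        (bi_skew_brace_op G (gamma_op G \<gamma>) \<longleftrightarrow> conj_equivariant G \<gamma>) \<and>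
        (bi_skew_brace_op G (gamma_op G \<gamma>) \<longleftrightarrow> anti_hom G \<gamma> \<and> conj_equivariant G \<gamma>) \<and>
        (bi_skew_brace_op G (gamma_op G \<gamma>) \<longleftrightarrow>
           (\<forall>s\<in>comm_subgroup G (gamma_bar G \<gamma>). \<gamma> s = \<one>\<^bsub>aut_group G\<^esub>)) \<and>
        (bi_skew_brace_op G (gamma_op G \<gamma>) \<longleftrightarrow>
           (\<forall>x\<in>carrier G. \<forall>y\<in>carrier G.
              \<gamma> (inv\<^bsub>G\<^esub> x \<otimes>\<^bsub>G\<^esub> inv\<^bsub>G\<^esub> y \<otimes>\<^bsub>G\<^esub> \<gamma> y x \<otimes>\<^bsub>G\<^esub> y)
                = \<one>\<^bsub>aut_group G\<^esub>))) \<and>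
     (\<forall>\<gamma> \<in> carrier G \<rightarrow>\<^sub>E auto G.
        anti_hom G \<gamma> \<and> conj_equivariant G \<gamma> \<longrightarrow> \<gamma> \<in> gamma_functions G)"
proof -
  interpret group G by (rule assms)
  have subgroup_eq: "\<forall>\<gamma>\<in>gamma_functions G. gamma_subgroup G \<gamma> = op_translations G (gamma_op G \<gamma>)"
    by (simp add: gamma_functionI gamma_function.gamma_subgroup_eq_translations)
  \<comment> \<open>Every condition is rewritten to \<open>anti_hom G \<gamma>\<close>, after which
    the equivalences are immediate; the last conjunct concerns maps not yet known to be gamma
    functions.\<close>
  show ?thesis
    by (intro conjI bij_betw_gamma_op bij_betw_gamma_subgroup subgroup_eq)
      (simp_all add: gamma_functionI gamma_function.bi_skew_brace_iff_anti_hom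
        gamma_function.normalised_iff_anti_hom gamma_function.conj_equivariant_iff_anti_hom
        gamma_function.gamma_comm_subgroup_iff_anti_hom
        gamma_function.gamma_commutator_iff_anti_hom
        anti_hom_conj_equivariant_imp_gamma_function)
qed

end
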